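(* Let $X$ be a nonempty set, let $\tau$ be the discrete topology on $X$, and let $G_\tau$ be the discrete topological graph of $X$. Then $G_\tau$ is a connected graph.
   Context: For a non-empty set $X$ with the discrete topology $\tau$ (so $\tau$ is the family of all subsets of $X$), the discrete topological graph $G_\tau=(V,E)$ is the graph with vertex set $V=\{A : A\in\tau,\ A\neq\emptyset,\ A\neq X\}$ and edge set $E=\{AB : A\cap B=\emptyset\}$, i.e. two vertices $A,B$ are adjacent if and only if $A\cap B=\emptyset$. *)

theory Defs
  imports "HOL-Analysis.Abstract_Topology" "Graph_Theory.Graph_Theory"
begin

hide_const (open) Topological_Spaces.connected

text \<open>
  Following \<^theory>\<open>Graph_Theory.Digraph\<close>, an undirected graph is a symmetric digraph: the
  edge \<open>AB\<close> is represented by the two arcs \<open>(A, B)\<close> and \<open>(B, A)\<close>. The locale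
  \<^locale>\<open>graph\<close> is not used because the underlying set may be infinite.
\<close>

definition topological_graph :: "'a topology \<Rightarrow> 'a set pair_pre_digraph" where
  "topological_graph T =
    (let V = {A. openin T A \<and> A \<noteq> {} \<and> A \<noteq> topspace T}
     in \<lparr>pverts = V, parcs = {(A, B). A \<in> V \<and> B \<in> V \<and> A \<inter> B = {}}\<rparr>)"

definition discrete_topological_graph :: "'a set \<Rightarrow> 'a set pair_pre_digraph" where
  "discrete_topological_graph X = topological_graph (discrete_topology X)"

text \<open>
  A graph is connected if any two of its vertices are joined by a path. The library constant
  \<^const>\<open>connected\<close> additionally requires a vertex; here the null graph, which is the
  discrete topological graph of a one-point set, is (vacuously) connected.
\<close>

definition connected_graph :: "('a, 'b) pre_digraph \<Rightarrow> bool" where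
  "connected_graph G \<longleftrightarrow> (verts G \<noteq> {} \<longrightarrow> connected G)"

lemma (in sym_digraph) connected_graph_iff_reachable:
  "connected_graph G \<longleftrightarrow> (\<forall>u \<in> verts G. \<forall>v \<in> verts G. u \<rightarrow>\<^sup>*\<^bsub>G\<^esub> v)"
  using reachable_mk_symmetric_eq[OF sym_arcs]
  by (auto simp: connected_graph_def connected_def strongly_connected_def)

lemma pverts_discrete_topological_graph:
  "pverts (discrete_topological_graph X) = {A. A \<subseteq> X \<and> A \<noteq> {} \<and> A \<noteq> X}"
  by (simp add: discrete_topological_graph_def topological_graph_def Let_def)

lemma parcs_discrete_topological_graph:
  "(A, B) \<in> parcs (discrete_topological_graph X) \<longleftrightarrow>
    A \<in> pverts (discrete_topological_graph X) \<and> B \<in> pverts (discrete_topological_graph X) \<and>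
    A \<inter> B = {}"
  by (simp add: discrete_topological_graph_def topological_graph_def Let_def)

lemma sym_digraph_discrete_topological_graph: "sym_digraph (discrete_topological_graph X)"
  by unfold_locales
     (auto simp: parcs_discrete_topological_graph symmetric_def intro!: symI)

lemma loopfree_digraph_discrete_topological_graph:
  "loopfree_digraph (discrete_topological_graph X)"
  by unfold_locales
     (auto simp: parcs_discrete_topological_graph pverts_discrete_topological_graph)

end

theory Submission
  imports Defs
begin

text \<open>
  Complements supply all the paths. A vertex \<open>A\<close> is adjacent to every nonempty subset of
  \<open>X - A\<close>. Given vertices \<open>A\<close> and \<open>B\<close>, consider \<open>X - (A \<union> B)\<close>. If it is nonempty, it is a common
  neighbour of \<open>A\<close> and \<open>B\<close>. If it is empty, then the neighbours \<open>X - A\<close> of \<open>A\<close> and \<open>X - B\<close> of \<open>B\<close>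
  are disjoint, since their intersection is \<open>X - (A \<union> B)\<close>; so they are adjacent to each other.
  Hence any two vertices are joined by a walk of length at most three.
\<close>

lemma adjacent_in_discrete_topological_graph:
  assumes "A \<subseteq> X" "B \<subseteq> X" "A \<noteq> {}" "B \<noteq> {}" "A \<inter> B = {}"
  shows "A \<rightarrow>\<^bsub>with_proj (discrete_topological_graph X)\<^esub> B"
proof -
  have "A \<noteq> X" "B \<noteq> X"
    using assms by auto
  then show ?thesis
    using assms
    by (simp add: parcs_discrete_topological_graph pverts_discrete_topological_graph)
qed

theorem theorem2p8:
  fixes X :: "'a set"
  assumes "X \<noteq> {}"
  shows "connected_graph (discrete_topological_graph X)"
proof -
  let ?G = "with_proj (discrete_topological_graph X)"
  interpret sym_digraph ?G
    by (rule sym_digraph_discrete_topological_graph)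
  have "A \<rightarrow>\<^sup>*\<^bsub>?G\<^esub> B" if "A \<in> verts ?G" and "B \<in> verts ?G" for A B
  proof -
    have A: "A \<subseteq> X" "A \<noteq> {}" "X - A \<noteq> {}" and B: "B \<subseteq> X" "B \<noteq> {}" "X - B \<noteq> {}"
      using that by (auto simp: pverts_discrete_topological_graph)
    show ?thesis
    proof (cases "X - (A \<union> B) = {}")
      case False
      have "A \<rightarrow>\<^bsub>?G\<^esub> (X - (A \<union> B))" "(X - (A \<union> B)) \<rightarrow>\<^bsub>?G\<^esub> B"
        using A B False by (intro adjacent_in_discrete_topological_graph; blast)+
      then show ?thesis
        by (meson reachable_adjI adj_reachable_trans)
    next
      case True
      have "A \<rightarrow>\<^bsub>?G\<^esub> (X - A)" "(X - A) \<rightarrow>\<^bsub>?G\<^esub> (X - B)" "(X - B) \<rightarrow>\<^bsub>?G\<^esub> B"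
        using A B True by (intro adjacent_in_discrete_topological_graph; blast)+
      then show ?thesis
        by (meson reachable_adjI adj_reachable_trans)
    qed
  qed
  then show ?thesis
    by (simp add: connected_graph_iff_reachable)
qed

end
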